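(* Let $\mathcal R_1=0,\dots,\mathcal R_k=0$ be a collection of trilinear relations which are assumed to have commutator form. Let $\mathcal C$ be the category of all algebras (with one product) satisfying these relations. Let $\mathfrak R$ be a weak Rota-Baxter operator (of weight zero) on an algebra $(A,\mu)$ which belongs to $\mathcal C$, and write $ab=\mu(a\otimes b)$. For $a,b\in A$, define $a\succ b:=\mathfrak R(a)b$ and $a\prec b:=a\mathfrak R(b)$. Then $(A,\prec,\succ)$ is a $\mathcal C$-dendriform algebra.
   Context: All structures are over a commutative ring $R$ in which $2$ is invertible. An algebra $(A,\mu_1,\dots,\mu_m)$ is an $R$-module $A$ with linear maps $\mu_i:A\otimes A\to A$ (products); no associativity, unit or other property is assumed. A trilinear relation is a relation $\mathcal R=0$ with $$\mathcal R(a_1,a_2,a_3)=\sum_{\sigma\in S_3}\lambda_\sigma (a_{\sigma(1)}a_{\sigma(2)})a_{\sigma(3)}+\sum_{\sigma\in S_3}\lambda'_\sigma a_{\sigma(1)}(a_{\sigma(2)}a_{\sigma(3)}),\qquad \lambda_\sigma,\lambda'_\sigma\in R;$$ an algebra satisfies it if $\mathcal R(a_1,a_2,a_3)=0$ for all $a_1,a_2,a_3\in A$. It has commutator form if $\mathcal R(a_1,a_2,a_3)=\sum_{\sigma\in S_3}c_\sigma[a_{\sigma(1)}a_{\sigma(2)},a_{\sigma(3)}]$ for some constants $c_\sigma\in R$, where $[u,v]:=uv-vu$. A set of trilinear relations has commutator form if it can equivalently be written as a set of trilinear relations each of which has commutator form. The objects of $\mathcal C$ are the algebras with one product satisfying all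 the given relations. An algebra $(A,\prec,\succ)$ is a $\mathcal C$-dendriform algebra if $(A\times A,\boxtimes)\in\mathcal C$, where for $(a,x),(b,y)\in A\times A$, $$(a,x)\boxtimes(b,y):=(a\prec b+a\succ b,\ a\succ y+x\prec b).$$ For an algebra $(A,\mu)$, let $C(A)$ be the set of $c\in A$ with $ca=ac$ for all $a\in A$. A weak Rota-Baxter operator (of weight zero) on $A$ is a linear map $\mathfrak R:A\to A$ such that $\mathfrak R(a\mathfrak R(b)+\mathfrak R(a)b)-\mathfrak R(a)\mathfrak R(b)\in C(A)$ for all $a,b\in A$. *)

theory Defs
  imports "HOL-Analysis.Product_Vector" "HOL-Combinatorics.Permutations"
begin

text \<open>
  The ground ring is a type \<open>'r\<close> of class \<open>comm_ring_1\<close>, and an \<open>'r\<close>-module is an instance of the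
  locale \<open>module\<close>. A linear map \<open>A \<otimes> A \<rightarrow> A\<close> is given by the corresponding bilinear map.
\<close>

locale nonassoc_algebra = module smul
  for smul :: "'r::comm_ring_1 \<Rightarrow> 'a::ab_group_add \<Rightarrow> 'a" +
  fixes mul :: "'a \<Rightarrow> 'a \<Rightarrow> 'a"
  assumes module_hom_mult_right: "\<And>a. module_hom smul smul (\<lambda>b. mul a b)"
    and module_hom_mult_left: "\<And>b. module_hom smul smul (\<lambda>a. mul a b)"

definition perms3 :: "(nat \<Rightarrow> nat) set"
  where "perms3 = {\<sigma>. \<sigma> permutes {1, 2, 3}}"

text \<open>
  A formal trilinear relation is its family of coefficients: \<open>Trilinear l r\<close> stands for
  \<open>\<Sum>\<^sub>\<sigma> l \<sigma> (a\<^bsub>\<sigma> 1\<^esub> a\<^bsub>\<sigma> 2\<^esub>) a\<^bsub>\<sigma> 3\<^esub> + \<Sum>\<^sub>\<sigma> r \<sigma> a\<^bsub>\<sigma> 1\<^esub> (a\<^bsub>\<sigma> 2\<^esub> a\<^bsub>\<sigma> 3\<^esub>)\<close>. The coefficients matter on \<open>perms3\<close> only, and the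
  triple \<open>(a\<^sub>1, a\<^sub>2, a\<^sub>3)\<close> is a function of which only the values at 1, 2, 3 matter.
\<close>

datatype 'r trilinear = Trilinear (lcoeff: "(nat \<Rightarrow> nat) \<Rightarrow> 'r") (rcoeff: "(nat \<Rightarrow> nat) \<Rightarrow> 'r")

definition trilinear_eval ::
    "('r \<Rightarrow> 'a \<Rightarrow> 'a) \<Rightarrow> ('a \<Rightarrow> 'a \<Rightarrow> 'a) \<Rightarrow> 'r trilinear \<Rightarrow> (nat \<Rightarrow> 'a::ab_group_add) \<Rightarrow> 'a"
  where "trilinear_eval smul mul Q a =
    (\<Sum>\<sigma>\<in>perms3. smul (lcoeff Q \<sigma>) (mul (mul (a (\<sigma> 1)) (a (\<sigma> 2))) (a (\<sigma> 3))))
    + (\<Sum>\<sigma>\<in>perms3. smul (rcoeff Q \<sigma>) (mul (a (\<sigma> 1)) (mul (a (\<sigma> 2)) (a (\<sigma> 3)))))"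

definition satisfies ::
    "('r \<Rightarrow> 'a \<Rightarrow> 'a) \<Rightarrow> ('a \<Rightarrow> 'a \<Rightarrow> 'a::ab_group_add) \<Rightarrow> 'r trilinear \<Rightarrow> bool"
  where "satisfies smul mul Q \<longleftrightarrow> (\<forall>a. trilinear_eval smul mul Q a = 0)"

text \<open>Membership of an algebra in the category \<open>\<C>\<close> defined by the relations \<open>S\<close>.\<close>

definition in_category ::
    "'r trilinear set \<Rightarrow> ('r::comm_ring_1 \<Rightarrow> 'a \<Rightarrow> 'a) \<Rightarrow> ('a \<Rightarrow> 'a \<Rightarrow> 'a::ab_group_add) \<Rightarrow> bool"
  where "in_category S smul mul \<longleftrightarrow>
    nonassoc_algebra smul mul \<and> (\<forall>Q\<in>S. satisfies smul mul Q)"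

text \<open>
  The expression \<open>\<Sum>\<^sub>\<sigma> c \<sigma> [a\<^bsub>\<sigma> 1\<^esub> a\<^bsub>\<sigma> 2\<^esub>, a\<^bsub>\<sigma> 3\<^esub>]\<close> contributes \<open>c \<sigma>\<close> to \<open>(a\<^bsub>\<sigma> 1\<^esub> a\<^bsub>\<sigma> 2\<^esub>) a\<^bsub>\<sigma> 3\<^esub>\<close> and \<open>- c \<sigma>\<close> to
  \<open>a\<^bsub>\<sigma> 3\<^esub> (a\<^bsub>\<sigma> 1\<^esub> a\<^bsub>\<sigma> 2\<^esub>)\<close>; the latter monomial has index \<open>\<sigma> \<circ> rot3\<close>.
\<close>

definition rot3 :: "nat \<Rightarrow> nat"
  where "rot3 = id(1 := 3, 2 := 1, 3 := 2)"

definition commutator_form :: "'r::comm_ring_1 trilinear \<Rightarrow> bool"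
  where "commutator_form Q \<longleftrightarrow>
    (\<exists>c. \<forall>\<sigma>\<in>perms3. lcoeff Q \<sigma> = c \<sigma> \<and> rcoeff Q (\<sigma> \<circ> rot3) = - c \<sigma>)"

text \<open>
  Two sets of relations are equivalent when they are satisfied by the same algebras. As HOL cannot
  quantify over types inside a formula, this is relative to a type \<open>'b\<close>: all module structures on
  the group \<open>'b\<close> and all products on them are considered. If the sets are satisfied by the same
  algebras over all modules (for instance because the relations of each set are linear combinations
  of those of the other with permuted variables), then they are equivalent on every \<open>'b\<close>. So
  \<open>has_commutator_form TYPE('b)\<close>, as an assumption, demands less than the property
  that refers to all modules.
\<close>

definition equivalent_on ::
    "'b::ab_group_add itself \<Rightarrow> 'r::comm_ring_1 trilinear set \<Rightarrow> 'r trilinear set \<Rightarrow> bool"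
  where "equivalent_on _ S S' \<longleftrightarrow>
    (\<forall>(smul :: 'r \<Rightarrow> 'b \<Rightarrow> 'b) mul. in_category S smul mul \<longleftrightarrow> in_category S' smul mul)"

definition has_commutator_form ::
    "'b::ab_group_add itself \<Rightarrow> 'r::comm_ring_1 trilinear set \<Rightarrow> bool"
  where "has_commutator_form T S \<longleftrightarrow>
    (\<exists>S'. (\<forall>Q\<in>S'. commutator_form Q) \<and> equivalent_on T S S')"

definition boxtimes ::
    "('a \<Rightarrow> 'a \<Rightarrow> 'a) \<Rightarrow> ('a \<Rightarrow> 'a \<Rightarrow> 'a) \<Rightarrow> 'a \<times> 'a \<Rightarrow> 'a \<times> 'a \<Rightarrow> 'a \<times> 'a::ab_group_add"
  where "boxtimes prec succ = (\<lambda>(a, x) (b, y). (prec a b + succ a b, succ a y + prec x b))"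

definition dendriform ::
    "'r trilinear set \<Rightarrow> ('r::comm_ring_1 \<Rightarrow> 'a \<Rightarrow> 'a) \<Rightarrow>
      ('a \<Rightarrow> 'a \<Rightarrow> 'a) \<Rightarrow> ('a \<Rightarrow> 'a \<Rightarrow> 'a::ab_group_add) \<Rightarrow> bool"
  where "dendriform S smul prec succ \<longleftrightarrow>
    nonassoc_algebra smul prec \<and> nonassoc_algebra smul succ \<and>
    in_category S (module_prod.scale smul smul) (boxtimes prec succ)"

definition center :: "('a \<Rightarrow> 'a \<Rightarrow> 'a) \<Rightarrow> 'a set"
  where "center mul = {c. \<forall>a. mul c a = mul a c}"

definition weak_rota_baxter ::
    "('r::comm_ring_1 \<Rightarrow> 'a \<Rightarrow> 'a) \<Rightarrow> ('a \<Rightarrow> 'a \<Rightarrow> 'a::ab_group_add) \<Rightarrow> ('a \<Rightarrow> 'a) \<Rightarrow> bool"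
  where "weak_rota_baxter smul mul P \<longleftrightarrow> module_hom smul smul P \<and>
    (\<forall>a b. P (mul a (P b) + mul (P a) b) - mul (P a) (P b) \<in> center mul)"

lemma bij_betw_comp_rot3: "bij_betw (\<lambda>\<sigma>. \<sigma> \<circ> rot3) perms3 perms3"
proof -
  have 1: "rot3 = transpose 1 2 \<circ> transpose 1 (3::nat)"
    by (auto simp: rot3_def fun_eq_iff transpose_def)
  have r: "rot3 permutes {1, 2, 3}"
    unfolding 1 by (intro permutes_compose permutes_swap_id) auto
  show ?thesis
    unfolding bij_betw_def perms3_def
  proof
    show "inj_on (\<lambda>\<sigma>. \<sigma> \<circ> rot3) {\<sigma>. \<sigma> permutes {1, 2, 3}}"
      by (rule inj_onI) (metis comp_assoc comp_id permutes_inv_o(1)[OF r])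
    show "(\<lambda>\<sigma>. \<sigma> \<circ> rot3) ` {\<sigma>. \<sigma> permutes {1, 2, 3}} = {\<sigma>. \<sigma> permutes {1, 2, 3}}"
      using image_compose_permutations_right[OF r] by (auto simp: image_def)
  qed
qed

lemma (in nonassoc_algebra) trilinear_eval_commutator:
  assumes "\<And>\<sigma>. \<sigma> \<in> perms3 \<Longrightarrow> lcoeff Q \<sigma> = c \<sigma> \<and> rcoeff Q (\<sigma> \<circ> rot3) = - c \<sigma>"
  shows "trilinear_eval smul mul Q a =
    (\<Sum>\<sigma>\<in>perms3. smul (c \<sigma>) (mul (mul (a (\<sigma> 1)) (a (\<sigma> 2))) (a (\<sigma> 3))
      - mul (a (\<sigma> 3)) (mul (a (\<sigma> 1)) (a (\<sigma> 2)))))"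
proof -
  have "(\<Sum>\<sigma>\<in>perms3. smul (rcoeff Q \<sigma>) (mul (a (\<sigma> 1)) (mul (a (\<sigma> 2)) (a (\<sigma> 3)))))
    = (\<Sum>\<sigma>\<in>perms3. smul (rcoeff Q (\<sigma> \<circ> rot3))
        (mul (a ((\<sigma> \<circ> rot3) 1)) (mul (a ((\<sigma> \<circ> rot3) 2)) (a ((\<sigma> \<circ> rot3) 3)))))"
    by (rule sum.reindex_bij_betw[OF bij_betw_comp_rot3, symmetric])
  also have "\<dots> = (\<Sum>\<sigma>\<in>perms3. - smul (c \<sigma>) (mul (a (\<sigma> 3)) (mul (a (\<sigma> 1)) (a (\<sigma> 2)))))"
  proof (rule sum.cong)
    have "rot3 1 = 3" "rot3 2 = 1" "rot3 3 = 2"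
      by (simp_all add: rot3_def)
    then show "smul (rcoeff Q (\<sigma> \<circ> rot3))
        (mul (a ((\<sigma> \<circ> rot3) 1)) (mul (a ((\<sigma> \<circ> rot3) 2)) (a ((\<sigma> \<circ> rot3) 3))))
      = - smul (c \<sigma>) (mul (a (\<sigma> 3)) (mul (a (\<sigma> 1)) (a (\<sigma> 2))))"
      if "\<sigma> \<in> perms3" for \<sigma>
      using assms[OF that] unfolding comp_apply by (simp only: scale_minus_left)
  qed simp
  finally show ?thesis
    by (simp add: trilinear_eval_def assms sum_negf sum_subtractf scale_right_diff_distrib)
qed

end

theory Submission
  imports Defs
begin

text \<open>
  Write \<open>P\<close> for the operator. A commutator in \<open>A \<times> A\<close> involves \<open>P (a P(b) + P(a) b)\<close> only inside a
  commutator of \<open>A\<close>, where it may be replaced by \<open>P(a) P(b)\<close> because the difference is central. For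
  a relation in commutator form this turns each component of the relation in \<open>A \<times> A\<close> into the
  relation of \<open>A\<close> evaluated at \<open>P(a\<^sub>1), P(a\<^sub>2), P(a\<^sub>3)\<close>, with one of the three entries
  replaced in turn, and summed.

  The relations are only equivalent to relations in commutator form on the group \<open>A \<times> A\<close>. The
  equivalence reaches \<open>A\<close> itself through the componentwise product on \<open>A \<times> A\<close>.
\<close>

lemma module_prod_scale_eq:
  fixes smul :: "'r::comm_ring_1 \<Rightarrow> 'a::ab_group_add \<Rightarrow> 'a"
  assumes "module smul"
  shows "module_prod.scale smul smul = (\<lambda>r x. (smul r (fst x), smul r (snd x)))"
proof -
  interpret module_prod smul smul
    using assms by (simp add: module_prod_def module_pair_def)
  show ?thesis
    by (auto simp: fun_eq_iff scale_def)
qed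

lemma module_module_prod:
  assumes "module smul"
  shows "module (module_prod.scale smul smul)"
proof -
  interpret module_prod smul smul
    using assms by (simp add: module_prod_def module_pair_def)
  show ?thesis
    by unfold_locales
qed

lemma nonassoc_algebra_iff:
  "nonassoc_algebra smul mul \<longleftrightarrow> module smul \<and>
    (\<forall>a b c. mul a (b + c) = mul a b + mul a c) \<and> (\<forall>a r b. mul a (smul r b) = smul r (mul a b)) \<and>
    (\<forall>a b c. mul (a + b) c = mul a c + mul b c) \<and> (\<forall>a r b. mul (smul r a) b = smul r (mul a b))"
  unfolding nonassoc_algebra_def nonassoc_algebra_axioms_def module_hom_iff by blast

definition prod_mult :: "('a \<Rightarrow> 'a \<Rightarrow> 'a) \<Rightarrow> 'a \<times> 'a \<Rightarrow> 'a \<times> 'a \<Rightarrow> 'a \<times> 'a"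
  where "prod_mult mul p q = (mul (fst p) (fst q), mul (snd p) (snd q))"

lemma trilinear_eval_prod_mult:
  assumes "module smul"
  shows "trilinear_eval (module_prod.scale smul smul) (prod_mult mul) Q p =
    (trilinear_eval smul mul Q (fst \<circ> p), trilinear_eval smul mul Q (snd \<circ> p))"
  by (simp add: trilinear_eval_def module_prod_scale_eq[OF assms] prod_mult_def prod_eq_iff
      fst_sum snd_sum)

text \<open>Evaluation in the product is componentwise, and triples on the diagonal recover every
  triple of the original algebra. An equivalence on \<open>'a \<times> 'a\<close> can thus be
  transferred to \<open>'a\<close>.\<close>

lemma in_category_prod_mult_iff:
  fixes smul :: "'r::comm_ring_1 \<Rightarrow> 'a::ab_group_add \<Rightarrow> 'a"
  assumes "nonassoc_algebra smul mul"
  shows "in_category S (module_prod.scale smul smul) (prod_mult mul) \<longleftrightarrow> in_category S smul mul"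
proof -
  have m: "module smul"
    using assms by (simp add: nonassoc_algebra_iff)
  have "nonassoc_algebra (module_prod.scale smul smul) (prod_mult mul)"
    using assms module_module_prod[OF m]
    by (simp add: nonassoc_algebra_iff module_prod_scale_eq[OF m] prod_mult_def)
  moreover have "satisfies (module_prod.scale smul smul) (prod_mult mul) Q \<longleftrightarrow> satisfies smul mul Q"
    for Q
  proof
    assume L: "satisfies (module_prod.scale smul smul) (prod_mult mul) Q"
    show "satisfies smul mul Q"
      unfolding satisfies_def
    proof
      fix a :: "nat \<Rightarrow> 'a"
      show "trilinear_eval smul mul Q a = 0"
        using L[unfolded satisfies_def trilinear_eval_prod_mult[OF m], rule_format, of "\<lambda>i. (a i, a i)"]
        by (simp add: comp_def zero_prod_def)
    qed
  qed (simp add: satisfies_def trilinear_eval_prod_mult[OF m] zero_prod_def)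
  ultimately show ?thesis
    using assms by (simp add: in_category_def)
qed

context nonassoc_algebra
begin

lemma mul_add: "mul a (b + c) = mul a b + mul a c" "mul (a + b) c = mul a c + mul b c"
  using nonassoc_algebra_axioms by (simp_all add: nonassoc_algebra_iff)

text \<open>This is the sum of the relation over three triples, each obtained from \<open>u\<close>
  by replacing one entry with that of \<open>v\<close>. The two replacements inside the inner
  product are collected in one commutator.\<close>

lemma polarized_relation:
  assumes Q: "\<forall>\<sigma>\<in>perms3. lcoeff Q \<sigma> = c \<sigma> \<and> rcoeff Q (\<sigma> \<circ> rot3) = - c \<sigma>"
    and sat: "satisfies smul mul Q"
  shows "(\<Sum>\<sigma>\<in>perms3. smul (c \<sigma>)
    (mul (mul (v (\<sigma> 1)) (u (\<sigma> 2)) + mul (u (\<sigma> 1)) (v (\<sigma> 2))) (u (\<sigma> 3))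
      - mul (u (\<sigma> 3)) (mul (v (\<sigma> 1)) (u (\<sigma> 2)) + mul (u (\<sigma> 1)) (v (\<sigma> 2)))
      + (mul (mul (u (\<sigma> 1)) (u (\<sigma> 2))) (v (\<sigma> 3)) - mul (v (\<sigma> 3)) (mul (u (\<sigma> 1)) (u (\<sigma> 2)))))) = 0"
    (is "(\<Sum>\<sigma>\<in>perms3. smul (c \<sigma>) (?t \<sigma>)) = 0")
proof -
  define w where "w i = u(i := v i)" for i :: nat
  define h where "h z \<sigma> = mul (mul (z (\<sigma> 1)) (z (\<sigma> 2))) (z (\<sigma> 3))
      - mul (z (\<sigma> 3)) (mul (z (\<sigma> 1)) (z (\<sigma> 2)))" for z :: "nat \<Rightarrow> 'a" and \<sigma> :: "nat \<Rightarrow> nat"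
  have t: "(\<Sum>i\<in>{1, 2, 3}. h (w i) \<sigma>) = ?t \<sigma>" if "\<sigma> \<in> perms3" for \<sigma>
  proof -
    have \<sigma>: "\<sigma> permutes {1, 2, 3}"
      using that by (simp add: perms3_def)
    have ne: "\<sigma> 1 \<noteq> \<sigma> 2" "\<sigma> 1 \<noteq> \<sigma> 3" "\<sigma> 2 \<noteq> \<sigma> 3"
      using permutes_inj[OF \<sigma>] by (simp_all add: inj_eq)
    \<comment> \<open>Reindexing by \<open>\<sigma>\<close> lets the sum run over the positions in
      the monomial, so that the replaced entry is known in each summand.\<close>
    have "(\<Sum>i\<in>{1, 2, 3}. h (w i) \<sigma>) = (\<Sum>i\<in>{1, 2, 3}. h (w (\<sigma> i)) \<sigma>)"
      using sum.permute[OF \<sigma>, of "\<lambda>i. h (w i) \<sigma>"] by (simp add: comp_def)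
    also have "\<dots> = h (w (\<sigma> 1)) \<sigma> + (h (w (\<sigma> 2)) \<sigma> + h (w (\<sigma> 3)) \<sigma>)"
      by simp
    also have "\<dots> = ?t \<sigma>"
      using ne ne[symmetric] by (simp add: h_def w_def mul_add)
    finally show ?thesis .
  qed
  have "(\<Sum>\<sigma>\<in>perms3. smul (c \<sigma>) (?t \<sigma>)) = (\<Sum>\<sigma>\<in>perms3. \<Sum>i\<in>{1, 2, 3}. smul (c \<sigma>) (h (w i) \<sigma>))"
    by (rule sum.cong) (simp_all only: t scale_sum_right[symmetric])
  also have "\<dots> = (\<Sum>i\<in>{1, 2, 3}. trilinear_eval smul mul Q (w i))"
    unfolding h_def by (subst sum.swap) (simp add: trilinear_eval_commutator[of Q c] Q)
  also have "\<dots> = 0"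
    using sat by (simp add: satisfies_def)
  finally show ?thesis .
qed

end

context
  fixes smul :: "'r::comm_ring_1 \<Rightarrow> 'a::ab_group_add \<Rightarrow> 'a" and mul P
  assumes algebra: "nonassoc_algebra smul mul" and P: "weak_rota_baxter smul mul P"
begin

interpretation nonassoc_algebra smul mul
  by (rule algebra)

abbreviation (input) "prec \<equiv> \<lambda>a b. mul a (P b)"
abbreviation (input) "succ \<equiv> \<lambda>a b. mul (P a) b"

lemma module_hom_P: "module_hom smul smul P"
  using P by (simp add: weak_rota_baxter_def)

lemma nonassoc_algebra_prec: "nonassoc_algebra smul prec"
  using algebra module_hom_P by (simp add: nonassoc_algebra_iff module_hom_iff)

lemma nonassoc_algebra_succ: "nonassoc_algebra smul succ"
  using algebra module_hom_P by (simp add: nonassoc_algebra_iff module_hom_iff)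

lemma nonassoc_algebra_boxtimes:
  "nonassoc_algebra (module_prod.scale smul smul) (boxtimes prec succ)"
  using nonassoc_algebra_prec nonassoc_algebra_succ module_module_prod[OF module_axioms]
  by (simp add: nonassoc_algebra_iff module_prod_scale_eq[OF module_axioms] boxtimes_def
      scale_right_distrib split_beta add_ac)

text \<open>The two inner elements differ by the central element \<open>d\<close>, which cancels in
  the commutator with \<open>z\<close>.\<close>

lemma commutator_P:
  "mul (P (mul a (P b) + mul (P a) b)) z - mul z (P (mul a (P b) + mul (P a) b)) =
    mul (mul (P a) (P b)) z - mul z (mul (P a) (P b))"
proof -
  define d where "d = P (mul a (P b) + mul (P a) b) - mul (P a) (P b)"
  have "mul d z = mul z d"
    using P by (simp add: weak_rota_baxter_def center_def d_def)
  moreover have "P (mul a (P b) + mul (P a) b) = mul (P a) (P b) + d"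
    by (simp add: d_def)
  ultimately show ?thesis
    by (simp add: mul_add)
qed

text \<open>Both components have the shape of a summand in \<open>polarized_relation\<close>, with
  \<open>u\<close> given by \<open>P\<close> of the first components; only \<open>v\<close>
  differs.\<close>

lemma boxtimes_commutator:
  fixes p q r :: "'a \<times> 'a"
  defines "t \<equiv> \<lambda>u v w. mul (mul u (P (fst q)) + mul (P (fst p)) v) (P (fst r))
      - mul (P (fst r)) (mul u (P (fst q)) + mul (P (fst p)) v)
      + (mul (mul (P (fst p)) (P (fst q))) w - mul w (mul (P (fst p)) (P (fst q))))"
  shows "boxtimes prec succ (boxtimes prec succ p q) r - boxtimes prec succ r (boxtimes prec succ p q)
    = (t (fst p) (fst q) (fst r), t (snd p) (snd q) (snd r))"
  \<comment> \<open>Read from right to left, \<open>commutator_P\<close> restores the values of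
    \<open>P\<close> on \<open>fst (boxtimes prec succ p q)\<close>, which the left-hand side
    contains.\<close>
  unfolding t_def commutator_P[symmetric]
  by (simp add: boxtimes_def split_beta prod_eq_iff add_diff_add
      add.commute[of "mul (P (fst p)) (snd q)"])

lemma satisfies_boxtimes:
  assumes "commutator_form Q" "satisfies smul mul Q"
  shows "satisfies (module_prod.scale smul smul) (boxtimes prec succ) Q"
proof -
  obtain c where c: "\<forall>\<sigma>\<in>perms3. lcoeff Q \<sigma> = c \<sigma> \<and> rcoeff Q (\<sigma> \<circ> rot3) = - c \<sigma>"
    using assms(1) unfolding commutator_form_def by blast
  show ?thesis
    unfolding satisfies_def
  proof
    fix p :: "nat \<Rightarrow> 'a \<times> 'a"
    note pol = polarized_relation[OF c assms(2), where u = "\<lambda>i. P (fst (p i))"]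
    show "trilinear_eval (module_prod.scale smul smul) (boxtimes prec succ) Q p = 0"
      \<comment> \<open>The two choices of \<open>v\<close> make the first and the second component
        vanish, respectively.\<close>
      using pol[of "\<lambda>i. fst (p i)"] pol[of "\<lambda>i. snd (p i)"]
      by (subst nonassoc_algebra.trilinear_eval_commutator[OF nonassoc_algebra_boxtimes bspec[OF c]])
        (simp_all add: boxtimes_commutator module_prod_scale_eq[OF module_axioms] prod_eq_iff
          fst_sum snd_sum)
  qed
qed

end

theorem proposition3p9:
  fixes smul :: "'r::comm_ring_1 \<Rightarrow> 'a::ab_group_add \<Rightarrow> 'a"
    and mul :: "'a \<Rightarrow> 'a \<Rightarrow> 'a"
    and rel :: "nat \<Rightarrow> 'r trilinear"
    and k :: nat
    and P :: "'a \<Rightarrow> 'a"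
  assumes two_invertible: "(2::'r) dvd 1"
    and "has_commutator_form TYPE('a \<times> 'a) (rel ` {1..k})"
    and "in_category (rel ` {1..k}) smul mul"
    and "weak_rota_baxter smul mul P"
  shows "dendriform (rel ` {1..k}) smul (\<lambda>a b. mul a (P b)) (\<lambda>a b. mul (P a) b)"
proof -
  have alg: "nonassoc_algebra smul mul"
    using assms(3) by (simp add: in_category_def)
  obtain S' where S': "\<forall>Q\<in>S'. commutator_form Q"
    and eq: "equivalent_on TYPE('a \<times> 'a) (rel ` {1..k}) S'"
    using assms(2) unfolding has_commutator_form_def by blast
  \<comment> \<open>The equivalence is used here for the componentwise product on
    \<open>'a \<times> 'a\<close>.\<close>
  have "in_category S' smul mul"
    using eq assms(3) in_category_prod_mult_iff[OF alg] unfolding equivalent_on_def by blast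
  then have "in_category S' (module_prod.scale smul smul)
      (boxtimes (\<lambda>a b. mul a (P b)) (\<lambda>a b. mul (P a) b))"
    using S' satisfies_boxtimes[OF alg assms(4)] nonassoc_algebra_boxtimes[OF alg assms(4)]
    by (simp add: in_category_def)
  \<comment> \<open>The equivalence is used in the other direction, now for
    \<open>boxtimes\<close>.\<close>
  then show ?thesis
    using eq nonassoc_algebra_prec[OF alg assms(4)] nonassoc_algebra_succ[OF alg assms(4)]
    unfolding dendriform_def equivalent_on_def by blast
qed

end
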